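(* Let $m\ge1$ be an integer, let $B_r^m$ denote the open ball of radius $r$ centred at $0$ in $\mathbb R^m$, let $\mathsf S\in\mathcal M(B_1^m;\operatorname{Sym}^+(\mathbb R^m))$ be a finite positive-semidefinite matrix-valued measure, and set $\mu:=\operatorname{tr}\mathsf S$. Assume that, for some $a\in\mathbb R^m$, $-\operatorname{div}\mathsf S=a\delta_0$ in $B_1^m$, in the sense that $$\int_{B_1^m}D\Psi:d\mathsf S=a\cdot\Psi(0)\qquad\text{for every }\Psi\in C_c^1(B_1^m;\mathbb R^m).$$ Suppose moreover that there is $c\in(0,1]$ such that for every $e\in\mathbb S^{m-1}$ $$e^T\mathsf Se\le c\,\mu\qquad\text{as measures}.$$ Then $r\mapsto r^{-1/c}\mu(B_r^m)$ is nondecreasing on $(0,1)$. If $c<1$, then $a=0$.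
   Context: $\operatorname{Sym}^+(\mathbb R^m)$ is the cone of symmetric positive-semidefinite $m\times m$ matrices, and $\mathcal M(U;\operatorname{Sym}^+(\mathbb R^m))$ denotes the Radon measures on $U$ with values in it. $A:B=\operatorname{tr}(A^*B)$; $\operatorname{tr}\mathsf S$ and $e^T\mathsf Se$ denote the scalar (nonnegative) measures obtained by applying the trace, respectively the quadratic form at $e$, to $\mathsf S$. $\delta_0$ is the Dirac mass at the origin. *)

theory Defs
  imports "HOL-Analysis.Analysis"
begin

definition sym_psd :: "real ^ 'n ^ 'n \<Rightarrow> bool" where
  "sym_psd A \<longleftrightarrow> transpose A = A \<and> (\<forall>x. 0 \<le> x \<bullet> (A *v x))"

text \<open>A finite matrix-valued measure on the measurable space \<open>M\<close> is a set function that is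
  \<open>\<sigma>\<close>-additive on \<open>sets M\<close>; the measure which \<open>M\<close> itself carries is irrelevant. On the Borel
  sets of an open subset of Euclidean space, such a set function is automatically Radon.\<close>

definition sym_psd_measure :: "'a measure \<Rightarrow> ('a set \<Rightarrow> real ^ 'n ^ 'n) \<Rightarrow> bool" where
  "sym_psd_measure M S \<longleftrightarrow>
     (\<forall>A\<in>sets M. sym_psd (S A)) \<and> S {} = 0 \<and>
     (\<forall>F :: nat \<Rightarrow> 'a set. range F \<subseteq> sets M \<longrightarrow> disjoint_family F \<longrightarrow>
        (\<lambda>k. S (F k)) sums S (\<Union>k. F k))"

definition trace_measure :: "('a set \<Rightarrow> real ^ 'n ^ 'n) \<Rightarrow> 'a set \<Rightarrow> real" where
  "trace_measure S A = trace (S A)"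

definition quad_measure :: "real ^ 'n \<Rightarrow> ('a set \<Rightarrow> real ^ 'n ^ 'n) \<Rightarrow> 'a set \<Rightarrow> real" where
  "quad_measure e S A = e \<bullet> (S A *v e)"

text \<open>The entries of a matrix-valued measure are signed measures. The integral against a finite
  signed measure \<open>\<nu>\<close> is defined by its Jordan decomposition \<open>\<nu> = \<nu>\<^sup>+ - \<nu>\<^sup>-\<close>, where
  \<open>\<nu>\<^sup>+ A = sup {\<nu> B | B \<subseteq> A}\<close> and \<open>\<nu>\<^sup>- = (- \<nu>)\<^sup>+\<close>. The coercion \<^const>\<open>ennreal\<close> sends negative
  values to \<open>0\<close>, which does not affect the supremum because \<open>B = {}\<close> is admitted.\<close>

definition upper_variation :: "'a measure \<Rightarrow> ('a set \<Rightarrow> real) \<Rightarrow> 'a measure" where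
  "upper_variation M \<nu> =
     measure_of (space M) (sets M) (\<lambda>A. SUP B\<in>{B \<in> sets M. B \<subseteq> A}. ennreal (\<nu> B))"

definition signed_integral :: "'a measure \<Rightarrow> ('a set \<Rightarrow> real) \<Rightarrow> ('a \<Rightarrow> real) \<Rightarrow> real" where
  "signed_integral M \<nu> f =
     (\<integral>x. f x \<partial>upper_variation M \<nu>) - (\<integral>x. f x \<partial>upper_variation M (\<lambda>A. - \<nu> A))"

text \<open>The integral of \<open>F : dS\<close>, with \<open>A : B = tr (A\<^sup>* B) = \<Sum>\<^sub>i\<^sub>j A\<^sub>i\<^sub>j B\<^sub>i\<^sub>j\<close>.\<close>

definition matrix_integral ::
  "'a measure \<Rightarrow> ('a set \<Rightarrow> real ^ 'n ^ 'm) \<Rightarrow> ('a \<Rightarrow> real ^ 'n ^ 'm) \<Rightarrow> real" where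
  "matrix_integral M S F =
     (\<Sum>i\<in>UNIV. \<Sum>j\<in>UNIV. signed_integral M (\<lambda>A. S A $ i $ j) (\<lambda>x. F x $ i $ j))"

text \<open>\<open>C\<^sub>c\<^sup>1(U; \<real>\<^sup>m)\<close> for open \<open>U\<close>. Functions are total, but only their values on \<open>U\<close> matter.\<close>

definition C1_compact_support :: "(real ^ 'n) set \<Rightarrow> (real ^ 'n \<Rightarrow> real ^ 'm) \<Rightarrow> bool" where
  "C1_compact_support U \<Psi> \<longleftrightarrow>
     \<Psi> differentiable_on U \<and>
     continuous_on U (\<lambda>x. jacobian \<Psi> (at x)) \<and>
     compact (closure {x \<in> U. \<Psi> x \<noteq> 0}) \<and>
     closure {x \<in> U. \<Psi> x \<noteq> 0} \<subseteq> U"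

text \<open>\<open>- div S = a \<delta>\<^sub>0\<close> in the open set \<open>U\<close>, in the sense of distributions. Here \<open>D\<Psi>\<close> has
  entries \<open>(D\<Psi>)\<^sub>i\<^sub>j = \<partial>\<^sub>j \<Psi>\<^sub>i\<close>.\<close>

definition neg_div_eq_dirac ::
  "(real ^ 'n) set \<Rightarrow> ((real ^ 'n) set \<Rightarrow> real ^ 'n ^ 'n) \<Rightarrow> real ^ 'n \<Rightarrow> bool" where
  "neg_div_eq_dirac U S a \<longleftrightarrow>
     (\<forall>\<Psi> :: real ^ 'n \<Rightarrow> real ^ 'n. C1_compact_support U \<Psi> \<longrightarrow>
        matrix_integral (restrict_space borel U) S (\<lambda>x. jacobian \<Psi> (at x)) = a \<bullet> \<Psi> 0)"

end

theory Submission
  imports Defs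
begin

text \<open>Testing the equation with radial fields \<open>\<phi>(\<bar>x\<bar>\<^sup>2) x\<close> turns it into a monotonicity formula. Write
\<open>S = F \<mu>\<close> with a matrix density \<open>F\<close> with respect to the trace measure \<open>\<mu>\<close>; then \<open>tr F = 1\<close> and
\<open>x \<bullet> F x \<le> c \<bar>x\<bar>\<^sup>2\<close> hold \<open>\<mu>\<close>-almost everywhere. The field \<open>f(\<bar>x\<bar>\<^sup>2) (k x + b)\<close> has the derivative
\<open>k f I + 2 f' (k x + b) x\<^sup>T\<close>, and the equation says that the \<open>\<mu>\<close>-integral of
\<open>k f(\<bar>x\<bar>\<^sup>2) + 2 f'(\<bar>x\<bar>\<^sup>2) (k x + b) \<bullet> F x\<close> equals \<open>f(0) (a \<bullet> b)\<close>.
Using \<open>\<bar>x\<bar>\<^sup>2\<close> instead of \<open>\<bar>x\<bar>\<close> as the radial variable makes these fields differentiable at the origin for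
every \<open>C\<^sup>1\<close> function \<open>f\<close> (\<open>radial_field_identity\<close>).

For the monotonicity take \<open>k = 1\<close>, \<open>b = 0\<close> and a nonincreasing \<open>f\<close>: the integral of
\<open>f(q) + 2 c q f'(q)\<close> with \<open>q = \<bar>x\<bar>\<^sup>2\<close> is at most zero. The differential equation asking that
\<open>- 2 c q f' - f\<close> be the difference \<open>t\<^sup>-\<^sup>\<beta> 1{q < t} - s\<^sup>-\<^sup>\<beta> 1{q < s}\<close>, with \<open>\<beta> = 1 / (2 c)\<close>,
has the explicit solution \<open>f(q) = (max s (min q t))\<^sup>-\<^sup>\<beta> - t\<^sup>-\<^sup>\<beta>\<close>, a truncated power, and with this
\<open>f\<close> the inequality is precisely the claimed monotonicity between the radii \<open>\<surd>s\<close> and \<open>\<surd>t\<close>. Since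
this \<open>f\<close> has corners at \<open>s\<close> and \<open>t\<close>, they are smoothed in \<open>truncated_power_profile\<close> at the cost of an
arbitrarily small error, which disappears in the limit (\<open>scaled_ball_mass_mono\<close>).

For the second claim take \<open>k = 0\<close>, \<open>b = a\<close> and a bump \<open>f\<close> at scale \<open>\<epsilon>\<close>. The identity gives
\<open>\<bar>a\<bar>\<^sup>2 \<le> C \<mu>(B\<^sub>\<epsilon>) / \<epsilon>\<close>. By the monotonicity \<open>\<mu>(B\<^sub>\<epsilon>)\<close> is at most of order \<open>\<epsilon> powr (1 / c)\<close>, so
for \<open>c < 1\<close> the right-hand side tends to zero (\<open>concentrated_force_eq_0\<close>).\<close>

section \<open>Signed set functions with a density\<close>

lemma emeasure_measure_of_real:
  fixes \<tau> :: "'a set \<Rightarrow> real"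
  assumes nonneg: "\<And>A. A \<in> sets M \<Longrightarrow> 0 \<le> \<tau> A"
    and empty: "\<tau> {} = 0"
    and additive: "\<And>F :: nat \<Rightarrow> 'a set. range F \<subseteq> sets M \<Longrightarrow> disjoint_family F \<Longrightarrow>
        (\<lambda>k. \<tau> (F k)) sums \<tau> (\<Union>k. F k)"
    and A: "A \<in> sets M"
  shows "emeasure (measure_of (space M) (sets M) (\<lambda>A. ennreal (\<tau> A))) A = ennreal (\<tau> A)"
proof (rule emeasure_measure_of_sigma)
  show "sigma_algebra (space M) (sets M)" ..
  show "positive (sets M) (\<lambda>A. ennreal (\<tau> A))"
    by (simp add: positive_def empty)
  show "countably_additive (sets M) (\<lambda>A. ennreal (\<tau> A))"
    unfolding countably_additive_def
    by (intro allI impI suminf_ennreal_eq additive) (auto intro: nonneg)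
qed (fact A)

text \<open>Because of the domination, adding the measure \<open>M\<close> to \<open>\<nu>\<close> yields a nonnegative measure that is
absolutely continuous, to which the Radon--Nikodym theorem applies; subtracting \<open>1\<close> from the
density undoes the shift.\<close>

lemma density_of_dominated_set_function:
  fixes \<nu> :: "'a set \<Rightarrow> real"
  assumes M: "finite_measure M"
    and additive: "\<And>F :: nat \<Rightarrow> 'a set. range F \<subseteq> sets M \<Longrightarrow> disjoint_family F \<Longrightarrow>
        (\<lambda>k. \<nu> (F k)) sums \<nu> (\<Union>k. F k)"
    and dominated: "\<And>A. A \<in> sets M \<Longrightarrow> \<bar>\<nu> A\<bar> \<le> measure M A"
  obtains f where "integrable M f" "\<And>A. A \<in> sets M \<Longrightarrow> \<nu> A = (LINT x:A|M. f x)"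
proof -
  interpret finite_measure M by fact
  define \<tau> where "\<tau> A = \<nu> A + measure M A" for A
  define N where "N = measure_of (space M) (sets M) (\<lambda>A. ennreal (\<tau> A))"
  have nonneg: "0 \<le> \<tau> A" if "A \<in> sets M" for A
    using dominated[OF that] by (simp add: \<tau>_def)
  have emeasure_N: "emeasure N A = ennreal (\<tau> A)" if "A \<in> sets M" for A
    unfolding N_def
  proof (rule emeasure_measure_of_real[OF nonneg _ _ that])
    show "\<tau> {} = 0"
      using dominated[of "{}"] by (simp add: \<tau>_def)
    show "(\<lambda>k. \<tau> (F k)) sums \<tau> (\<Union>k. F k)"
      if "range F \<subseteq> sets M" "disjoint_family F" for F :: "nat \<Rightarrow> 'a set"
      unfolding \<tau>_def using that by (intro sums_add additive finite_measure_UNION)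
  qed
  have sets_N [simp]: "sets N = sets M" and space_N [simp]: "space N = space M"
    by (simp_all add: N_def)
  have fin_N: "finite_measure N"
    by (rule finite_measureI) (simp add: emeasure_N)
  have "absolutely_continuous M N"
    unfolding absolutely_continuous_def
  proof
    fix A assume A: "A \<in> null_sets M"
    then have "measure M A = 0" "A \<in> sets M" by (auto simp: measure_eq_0_null_sets)
    with dominated[of A] show "A \<in> null_sets N"
      by (auto simp: null_sets_def emeasure_N \<tau>_def)
  qed
  then obtain D where D: "D \<in> borel_measurable M" "AE x in M. RN_deriv M N x = ennreal (D x)"
      "\<And>x. 0 \<le> D x"
    using real_RN_deriv[OF fin_N _ sets_N] by metis
  have "density M (\<lambda>x. ennreal (D x)) = density M (RN_deriv M N)"
    using D by (intro density_cong) auto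
  also have "\<dots> = N"
    using \<open>absolutely_continuous M N\<close> by (intro density_RN_deriv) simp_all
  finally have N_eq: "density M (\<lambda>x. ennreal (D x)) = N" .
  have "integrable N (\<lambda>x. 1::real)"
    using fin_N by (rule finite_measure.integrable_const)
  then have int_D: "integrable M D"
    using D by (simp add: N_eq[symmetric] integrable_real_density)
  show thesis
  proof
    show "integrable M (\<lambda>x. D x - 1)" using int_D by simp
    fix A assume A: "A \<in> sets M"
    have "(LINT x:A|M. D x) = (\<integral>x. indicator A x \<partial>N)"
      using D A unfolding N_eq[symmetric] set_lebesgue_integral_def
      by (subst integral_real_density) (auto simp: mult.commute)
    also have "\<dots> = \<tau> A"
      using A nonneg[OF A] sets.sets_into_space[OF A] by (simp add: measure_def emeasure_N Int_absorb1 Int_absorb2)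
    finally have "(LINT x:A|M. D x) = \<tau> A" .
    then have "\<nu> A = (LINT x:A|M. D x) - (LINT x:A|M. 1)"
      using A sets.sets_into_space[OF A] by (simp add: \<tau>_def set_lebesgue_integral_def Int_absorb1 Int_absorb2)
    also have "\<dots> = (LINT x:A|M. D x - 1)"
      using int_D A
      by (intro set_integral_diff(2)[symmetric]) (simp_all add: set_integrable_def integrable_mult_indicator del: real_scaleR_def)
    finally show "\<nu> A = (LINT x:A|M. D x - 1)" .
  qed
qed

lemma AE_le_of_set_integral_le:
  fixes f g :: "'a \<Rightarrow> real"
  assumes f: "integrable M f" and g: "integrable M g"
    and le: "\<And>A. A \<in> sets M \<Longrightarrow> (LINT x:A|M. f x) \<le> (LINT x:A|M. g x)"
  shows "AE x in M. f x \<le> g x"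
proof -
  define A where "A = {x \<in> space M. g x < f x}"
  have [measurable]: "f \<in> borel_measurable M" "g \<in> borel_measurable M"
    using f g by auto
  have A [measurable]: "A \<in> sets M" unfolding A_def by measurable
  have int: "integrable M (\<lambda>x. indicator A x * (f x - g x))"
    using f g A integrable_mult_indicator[of A M "\<lambda>x. f x - g x"] by simp
  have "(\<integral>x. indicator A x * (f x - g x) \<partial>M) = (LINT x:A|M. f x) - (LINT x:A|M. g x)"
    using f g A
    by (subst set_integral_diff(2)[symmetric])
       (auto simp: set_integrable_def set_lebesgue_integral_def right_diff_distrib
         intro!: integrable_mult_indicator[where 'b=real, simplified])
  then have "(\<integral>x. indicator A x * (f x - g x) \<partial>M) \<le> 0" using le[OF A] by simp
  moreover have nn: "0 \<le> indicator A x * (f x - g x)" for x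
    by (auto simp: A_def indicator_def)
  ultimately have "(\<integral>x. indicator A x * (f x - g x) \<partial>M) = 0"
    using Bochner_Integration.integral_nonneg[OF nn] by (intro antisym) auto
  then have "AE x in M. indicator A x * (f x - g x) = 0"
    using integral_nonneg_eq_0_iff_AE[OF int] nn by auto
  then show ?thesis
    using AE_space by eventually_elim (auto simp: A_def indicator_def split: if_splits)
qed

text \<open>The supremum of \<open>\<nu> B\<close> over \<open>B \<subseteq> A\<close> is attained where the density is positive, at
\<open>B = A \<inter> {f > 0}\<close>; the coercion \<open>ennreal\<close> cuts \<open>f\<close> down to its positive part.\<close>

lemma upper_variation_eq_density:
  fixes f :: "'a \<Rightarrow> real"
  assumes f: "integrable N f" and sets_N: "sets N = sets M"
    and \<nu>: "\<And>A. A \<in> sets M \<Longrightarrow> \<nu> A = (LINT x:A|N. f x)"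
  shows "upper_variation M \<nu> = density N (\<lambda>x. ennreal (f x))"
proof -
  have space_N: "space N = space M" using sets_N by (rule sets_eq_imp_space_eq)
  have [measurable]: "f \<in> borel_measurable N" using f by auto
  have "(SUP B\<in>{B \<in> sets M. B \<subseteq> A}. ennreal (\<nu> B)) = (\<integral>\<^sup>+x. ennreal (f x) * indicator A x \<partial>N)"
    if "A \<in> sets M" for A
  proof (rule antisym)
    show "(SUP B\<in>{B \<in> sets M. B \<subseteq> A}. ennreal (\<nu> B)) \<le> (\<integral>\<^sup>+x. ennreal (f x) * indicator A x \<partial>N)"
    proof (rule SUP_least, clarify)
      fix B assume B: "B \<in> sets M" "B \<subseteq> A"
      have "ennreal (\<nu> B) \<le> ennreal (\<integral>x. max 0 (f x) * indicator A x \<partial>N)"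
        unfolding \<nu>[OF B(1)] set_lebesgue_integral_def
        using B that f
        by (intro ennreal_leI integral_mono integrable_real_mult_indicator integrable_mult_indicator
             integrable_max) (auto simp: sets_N indicator_def)
      also have "\<dots> = (\<integral>\<^sup>+x. ennreal (max 0 (f x) * indicator A x) \<partial>N)"
        using that f
        by (intro nn_integral_eq_integral[symmetric] integrable_real_mult_indicator integrable_max)
           (auto simp: sets_N)
      also have "\<dots> = (\<integral>\<^sup>+x. ennreal (f x) * indicator A x \<partial>N)"
        by (intro nn_integral_cong) (auto simp: indicator_def max_def ennreal_neg)
      finally show "ennreal (\<nu> B) \<le> (\<integral>\<^sup>+x. ennreal (f x) * indicator A x \<partial>N)" .
    qed
    define B where "B = A \<inter> {x \<in> space N. 0 < f x}"
    have B: "B \<in> sets N" using that unfolding B_def sets_N[symmetric] by measurable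
    have "(\<integral>\<^sup>+x. ennreal (f x) * indicator A x \<partial>N) = (\<integral>\<^sup>+x. ennreal (indicator B x *\<^sub>R f x) \<partial>N)"
      by (intro nn_integral_cong) (auto simp: B_def indicator_def ennreal_neg not_less)
    also have "\<dots> = ennreal (\<nu> B)"
      using B f unfolding \<nu>[OF B[unfolded sets_N]] set_lebesgue_integral_def
      by (intro nn_integral_eq_integral integrable_mult_indicator) (auto simp: B_def indicator_def)
    also have "\<dots> \<le> (SUP B\<in>{B \<in> sets M. B \<subseteq> A}. ennreal (\<nu> B))"
      using B by (intro SUP_upper) (auto simp: B_def sets_N)
    finally show "(\<integral>\<^sup>+x. ennreal (f x) * indicator A x \<partial>N) \<le> \<dots>" .
  qed
  then show ?thesis
    unfolding upper_variation_def density_def space_N sets_N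
    by (intro measure_of_eq) (auto simp: sets.sigma_sets_eq sets.space_closed)
qed

lemma signed_integral_eq_integral_density:
  fixes f g :: "'a \<Rightarrow> real"
  assumes f: "integrable N f" and sets_N: "sets N = sets M"
    and \<nu>: "\<And>A. A \<in> sets M \<Longrightarrow> \<nu> A = (LINT x:A|N. f x)"
    and g: "g \<in> borel_measurable N" and fg: "integrable N (\<lambda>x. f x * g x)"
  shows "signed_integral M \<nu> g = (\<integral>x. f x * g x \<partial>N)"
proof -
  have [measurable]: "f \<in> borel_measurable N" using f by auto
  have ennreal_max_0: "ennreal (max 0 y) = ennreal y" for y
    by (simp add: max_def ennreal_neg)
  have pos: "upper_variation M \<nu> = density N (\<lambda>x. ennreal (max 0 (f x)))"
    using upper_variation_eq_density[OF f sets_N \<nu>] by (simp add: ennreal_max_0)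
  have neg: "upper_variation M (\<lambda>A. - \<nu> A) = density N (\<lambda>x. ennreal (max 0 (- f x)))"
  proof -
    have "upper_variation M (\<lambda>A. - \<nu> A) = density N (\<lambda>x. ennreal (- f x))"
      by (rule upper_variation_eq_density[OF _ sets_N])
         (use f in \<open>auto simp: \<nu> set_lebesgue_integral_def\<close>)
    then show ?thesis by (simp add: ennreal_max_0)
  qed
  have int: "integrable N (\<lambda>x. max 0 (f x) * g x)" "integrable N (\<lambda>x. max 0 (- f x) * g x)"
    using g by (auto intro!: Bochner_Integration.integrable_bound[OF fg] AE_I2 mult_right_mono simp: abs_mult)
  have "signed_integral M \<nu> g = (\<integral>x. max 0 (f x) * g x \<partial>N) - (\<integral>x. max 0 (- f x) * g x \<partial>N)"
    unfolding signed_integral_def pos neg using g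
    by (simp add: integral_real_density)
  also have "\<dots> = (\<integral>x. max 0 (f x) * g x - max 0 (- f x) * g x \<partial>N)"
    using int by simp
  also have "\<dots> = (\<integral>x. f x * g x \<partial>N)"
    by (intro Bochner_Integration.integral_cong) (auto simp: max_def)
  finally show ?thesis .
qed

section \<open>The density of a matrix measure with respect to its trace\<close>

lemma axis_inner_matrix_axis:
  fixes A :: "real ^ 'n ^ 'n"
  shows "axis i 1 \<bullet> (A *v axis j 1) = A $ i $ j"
  by (simp add: matrix_vector_mult_basis column_def inner_axis')

text \<open>Positivity of the quadratic form at \<open>e\<^sub>i \<plusminus> e\<^sub>j\<close> bounds twice the entry by the sum of two diagonal
entries, each of which is at most the trace. This is what makes all entries of a positive
semidefinite matrix measure absolutely continuous with respect to its trace.\<close>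

lemma sym_psd_entry_le_trace:
  assumes A: "sym_psd A"
  shows "\<bar>A $ i $ j\<bar> \<le> trace A"
proof -
  have psd: "0 \<le> x \<bullet> (A *v x)" for x
    using A by (simp add: sym_psd_def)
  have "transpose A $ j $ i = A $ j $ i"
    using A by (simp add: sym_psd_def)
  then have sym: "A $ i $ j = A $ j $ i"
    by (simp add: transpose_def)
  have diag: "0 \<le> A $ k $ k" for k
    using psd[of "axis k 1"] by (simp add: axis_inner_matrix_axis)
  have le_trace: "A $ k $ k \<le> trace A" for k
    unfolding trace_def using diag by (intro member_le_sum) auto
  have "0 \<le> A $ i $ i + 2 * A $ i $ j + A $ j $ j"
    using psd[of "axis i 1 + axis j 1"] sym
    by (simp add: algebra_simps matrix_vector_right_distrib inner_add_left axis_inner_matrix_axis)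
  moreover have "0 \<le> A $ i $ i - 2 * A $ i $ j + A $ j $ j"
    using psd[of "axis i 1 - axis j 1"] sym
    by (simp add: algebra_simps matrix_vector_mult_diff_distrib inner_diff_left inner_diff_right axis_inner_matrix_axis)
  ultimately show ?thesis
    using le_trace[of i] le_trace[of j] by linarith
qed

lemma inner_matrix_vector_eq_sum:
  fixes A :: "real ^ 'n ^ 'n"
  shows "v \<bullet> (A *v x) = (\<Sum>i\<in>UNIV. \<Sum>j\<in>UNIV. A $ i $ j * (v $ i * x $ j))"
  by (simp add: inner_vec_def matrix_vector_mult_def sum_distrib_left mult_ac)

text \<open>The polar form \<open>S = F \<mu>\<close> of a matrix measure with respect to its trace \<open>\<mu>\<close>. The pointwise
properties of \<open>F\<close> hold only almost everywhere and are derived from the corresponding setwise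
properties of \<open>S\<close>.\<close>

locale matrix_measure_density = finite_measure \<mu> for \<mu> :: "'a measure" +
  fixes M :: "'a measure" and S :: "'a set \<Rightarrow> real ^ 'n ^ 'n" and F :: "'a \<Rightarrow> real ^ 'n ^ 'n"
  assumes sets_mu: "sets \<mu> = sets M"
    and measure_mu: "\<And>A. A \<in> sets M \<Longrightarrow> measure \<mu> A = trace_measure S A"
    and integrable_F: "\<And>i j. integrable \<mu> (\<lambda>x. F x $ i $ j)"
    and S_eq: "\<And>A i j. A \<in> sets M \<Longrightarrow> S A $ i $ j = (LINT x:A|\<mu>. F x $ i $ j)"
    and entry_le_trace: "\<And>A i j. A \<in> sets M \<Longrightarrow> \<bar>S A $ i $ j\<bar> \<le> trace_measure S A"

lemma sym_psd_measure_has_density: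
  fixes S :: "'a set \<Rightarrow> real ^ 'n ^ 'n"
  assumes S: "sym_psd_measure M S"
  obtains \<mu> F where "matrix_measure_density \<mu> M S F"
proof -
  define \<mu> where "\<mu> = measure_of (space M) (sets M) (\<lambda>A. ennreal (trace_measure S A))"
  have sums: "(\<lambda>k. S (F k) $ i $ j) sums (S (\<Union>k. F k) $ i $ j)"
    if "range F \<subseteq> sets M" "disjoint_family F" for F :: "nat \<Rightarrow> 'a set" and i j
    using S that unfolding sym_psd_measure_def
    by (intro bounded_linear.sums[OF bounded_linear_vec_nth]) auto
  have entry_le: "\<bar>S A $ i $ j\<bar> \<le> trace_measure S A" if "A \<in> sets M" for A i j
    using S that by (auto simp: sym_psd_measure_def trace_measure_def intro: sym_psd_entry_le_trace)
  then have trace_nonneg: "0 \<le> trace_measure S A" if "A \<in> sets M" for A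
    using that by (meson abs_ge_zero order_trans)
  have emeasure_mu: "emeasure \<mu> A = ennreal (trace_measure S A)" if "A \<in> sets M" for A
    unfolding \<mu>_def
  proof (rule emeasure_measure_of_real[OF trace_nonneg _ _ that])
    show "trace_measure S {} = 0"
      using S by (simp add: sym_psd_measure_def trace_measure_def trace_def)
  qed (auto simp: trace_measure_def trace_def intro!: sums_sum sums)
  have sets_mu: "sets \<mu> = sets M" and space_mu: "space \<mu> = space M"
    by (simp_all add: \<mu>_def)
  have fin: "finite_measure \<mu>"
    by (rule finite_measureI) (simp add: emeasure_mu space_mu)
  have measure_mu: "measure \<mu> A = trace_measure S A" if "A \<in> sets M" for A
    using that by (simp add: measure_def emeasure_mu trace_nonneg)
  have "\<exists>f. integrable \<mu> f \<and> (\<forall>A\<in>sets M. S A $ i $ j = (LINT x:A|\<mu>. f x))" for i j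
    by (rule density_of_dominated_set_function[OF fin, of "\<lambda>A. S A $ i $ j"])
       (auto simp: sets_mu measure_mu intro: sums entry_le)
  then obtain f where "\<And>i j. integrable \<mu> (f i j)"
      "\<And>i j A. A \<in> sets M \<Longrightarrow> S A $ i $ j = (LINT x:A|\<mu>. f i j x)"
    by metis
  then have "matrix_measure_density \<mu> M S (\<lambda>x. \<chi> i j. f i j x)"
    by (intro matrix_measure_density.intro fin matrix_measure_density_axioms.intro entry_le)
       (simp_all add: sets_mu measure_mu)
  then show thesis ..
qed

context matrix_measure_density
begin

lemma borel_measurable_F [measurable]: "(\<lambda>x. F x $ i $ j) \<in> borel_measurable \<mu>"
  using integrable_F by auto

lemma set_integral_one: "A \<in> sets M \<Longrightarrow> (LINT x:A|\<mu>. k) = k * trace_measure S A" for k :: real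
  using sets.sets_into_space[of A \<mu>]
  by (simp add: set_lebesgue_integral_def sets_mu measure_mu Int_absorb1 Int_absorb2)

lemma AE_entry_le_1: "AE x in \<mu>. \<forall>i j. \<bar>F x $ i $ j\<bar> \<le> 1"
proof -
  have "AE x in \<mu>. \<bar>F x $ i $ j\<bar> \<le> 1" for i j
  proof -
    have "AE x in \<mu>. F x $ i $ j \<le> 1"
      using abs_le_D1[OF entry_le_trace]
      by (intro AE_le_of_set_integral_le integrable_F) (auto simp: sets_mu set_integral_one S_eq[symmetric])
    moreover have "AE x in \<mu>. - 1 \<le> F x $ i $ j"
    proof (rule AE_le_of_set_integral_le)
      fix A assume "A \<in> sets \<mu>"
      then show "(LINT x:A|\<mu>. - 1) \<le> (LINT x:A|\<mu>. F x $ i $ j)"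
        using entry_le_trace[of A i j] by (simp add: sets_mu set_integral_one S_eq[symmetric])
    qed (simp_all add: integrable_F)
    ultimately show ?thesis
      by eventually_elim auto
  qed
  then show ?thesis by (simp add: AE_all_countable)
qed

lemma set_integral_linear_combination:
  assumes A: "A \<in> sets M"
  shows "(LINT x:A|\<mu>. (\<Sum>i\<in>UNIV. \<Sum>j\<in>UNIV. F x $ i $ j * w i j))
           = (\<Sum>i\<in>UNIV. \<Sum>j\<in>UNIV. S A $ i $ j * w i j)"
proof -
  have *: "integrable \<mu> (\<lambda>x. indicator A x * F x $ i $ j)" for i j
    using integrable_mult_indicator[OF _ integrable_F, of A] A by (simp add: sets_mu)
  have "(LINT x:A|\<mu>. (\<Sum>i\<in>UNIV. \<Sum>j\<in>UNIV. F x $ i $ j * w i j))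
      = (\<integral>x. (\<Sum>i\<in>UNIV. \<Sum>j\<in>UNIV. (indicator A x * F x $ i $ j) * w i j) \<partial>\<mu>)"
    by (simp add: set_lebesgue_integral_def sum_distrib_left mult.assoc)
  also have "\<dots> = (\<Sum>i\<in>UNIV. \<Sum>j\<in>UNIV. (\<integral>x. indicator A x * F x $ i $ j \<partial>\<mu>) * w i j)"
    using * by simp
  finally show ?thesis
    using A by (simp add: S_eq set_lebesgue_integral_def)
qed

lemma AE_trace_eq_1: "AE x in \<mu>. trace (F x) = 1"
proof -
  have trace_eq: "trace B = (\<Sum>i\<in>UNIV. \<Sum>j\<in>UNIV. B $ i $ j * of_bool (i = j))" for B :: "real ^ 'n ^ 'n"
    by (simp add: trace_def of_bool_def if_distrib cong: if_cong)
  have int: "integrable \<mu> (\<lambda>x. trace (F x))"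
    by (simp add: trace_def integrable_F)
  have eq: "(LINT x:A|\<mu>. trace (F x)) = (LINT x:A|\<mu>. 1)" if "A \<in> sets \<mu>" for A
    using that unfolding trace_eq
    by (subst set_integral_linear_combination)
       (simp_all only: sets_mu trace_eq[symmetric] set_integral_one trace_measure_def mult_1)
  have "AE x in \<mu>. trace (F x) \<le> 1" "AE x in \<mu>. 1 \<le> trace (F x)"
    by (auto intro!: AE_le_of_set_integral_le int simp: eq)
  then show ?thesis by eventually_elim simp
qed

text \<open>The hypothesis compares measures for one fixed vector \<open>e\<close> at a time, and so gives a null set that
depends on \<open>e\<close>, whereas the vector of interest is the position \<open>x\<close> itself. Choosing \<open>e\<close> in a
countable dense set makes the null set uniform, and the inequality is a closed condition on \<open>e\<close>.\<close>

lemma AE_quadratic_form_le: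
  assumes quad_le: "\<And>e A. e \<in> sphere 0 1 \<Longrightarrow> A \<in> sets M \<Longrightarrow>
           quad_measure e S A \<le> c * trace_measure S A"
  shows "AE x in \<mu>. \<forall>e. e \<bullet> (F x *v e) \<le> c * (e \<bullet> e)"
proof -
  obtain E :: "(real ^ 'n) set" where E: "countable E"
      "\<And>X. open X \<Longrightarrow> X \<noteq> {} \<Longrightarrow> \<exists>d\<in>E. d \<in> X"
    using countable_dense_setE by blast
  have quad_le': "quad_measure e S A \<le> (c * (e \<bullet> e)) * trace_measure S A" if A: "A \<in> sets M" for e A
  proof (cases "e = 0")
    case False
    define u where "u = e /\<^sub>R norm e"
    have e: "e = norm e *\<^sub>R u" and "u \<in> sphere 0 1"
      using False by (simp_all add: u_def)
    have "quad_measure e S A = (norm e)\<^sup>2 * quad_measure u S A"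
      unfolding quad_measure_def
      by (subst (1 2) e) (simp add: matrix_vector_mult_scaleR power2_eq_square)
    also have "\<dots> \<le> (norm e)\<^sup>2 * (c * trace_measure S A)"
      by (intro mult_left_mono quad_le A \<open>u \<in> sphere 0 1\<close>) simp
    finally show ?thesis by (simp add: power2_norm_eq_inner mult_ac)
  qed (simp add: quad_measure_def)
  have "AE x in \<mu>. e \<bullet> (F x *v e) \<le> c * (e \<bullet> e)" for e
  proof (rule AE_le_of_set_integral_le)
    show "integrable \<mu> (\<lambda>x. e \<bullet> (F x *v e))"
      by (simp add: inner_matrix_vector_eq_sum integrable_F)
    show "(LINT x:A|\<mu>. e \<bullet> (F x *v e)) \<le> (LINT x:A|\<mu>. c * (e \<bullet> e))" if "A \<in> sets \<mu>" for A
    proof -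
      have A: "A \<in> sets M" using that by (simp only: sets_mu)
      have "(LINT x:A|\<mu>. e \<bullet> (F x *v e)) = quad_measure e S A"
        unfolding inner_matrix_vector_eq_sum quad_measure_def by (rule set_integral_linear_combination[OF A])
      then show ?thesis
        using quad_le'[OF A, of e] by (simp only: set_integral_one[OF A])
    qed
  qed simp
  then have "AE x in \<mu>. \<forall>e\<in>E. e \<bullet> (F x *v e) \<le> c * (e \<bullet> e)"
    using E(1) by (simp add: AE_ball_countable)
  then show ?thesis
  proof eventually_elim
    case (elim x)
    define X where "X = {e. c * (e \<bullet> e) < e \<bullet> (F x *v e)}"
    have "open X"
      unfolding X_def by (intro open_Collect_less continuous_intros matrix_vector_mult_linear_continuous_on)
    with E(2) elim have "X = {}" by (force simp: X_def not_less)
    then show ?case by (auto simp: X_def not_less)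
  qed
qed

text \<open>Reduces the entrywise Jordan decompositions in the definition of the matrix integral to a single
Lebesgue integral of \<open>F : G\<close> with respect to the trace measure.\<close>

lemma matrix_integral_eq:
  assumes G: "\<And>i j. (\<lambda>x. G x $ i $ j) \<in> borel_measurable \<mu>"
    and bounded: "\<And>i j x. x \<in> space M \<Longrightarrow> \<bar>G x $ i $ j\<bar> \<le> B"
  shows "integrable \<mu> (\<lambda>x. \<Sum>i\<in>UNIV. \<Sum>j\<in>UNIV. F x $ i $ j * G x $ i $ j)"
    and "matrix_integral M S G = (\<integral>x. (\<Sum>i\<in>UNIV. \<Sum>j\<in>UNIV. F x $ i $ j * G x $ i $ j) \<partial>\<mu>)"
proof -
  have space_mu: "space \<mu> = space M" using sets_mu by (rule sets_eq_imp_space_eq)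
  have int: "integrable \<mu> (\<lambda>x. F x $ i $ j * G x $ i $ j)" for i j
  proof (rule Bochner_Integration.integrable_bound[of \<mu> "\<lambda>x. B * F x $ i $ j"])
    show "AE x in \<mu>. norm (F x $ i $ j * G x $ i $ j) \<le> norm (B * F x $ i $ j)"
    proof (rule AE_I2)
      fix x assume "x \<in> space \<mu>"
      then have "\<bar>G x $ i $ j\<bar> \<le> B" using bounded by (simp add: space_mu)
      then have "\<bar>F x $ i $ j\<bar> * \<bar>G x $ i $ j\<bar> \<le> \<bar>F x $ i $ j\<bar> * \<bar>B\<bar>"
        by (intro mult_left_mono) auto
      then show "norm (F x $ i $ j * G x $ i $ j) \<le> norm (B * F x $ i $ j)"
        by (simp add: abs_mult mult.commute)
    qed
  qed (use G integrable_F in auto)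
  then show "integrable \<mu> (\<lambda>x. \<Sum>i\<in>UNIV. \<Sum>j\<in>UNIV. F x $ i $ j * G x $ i $ j)" by simp
  have "signed_integral M (\<lambda>A. S A $ i $ j) (\<lambda>x. G x $ i $ j) = (\<integral>x. F x $ i $ j * G x $ i $ j \<partial>\<mu>)" for i j
    by (rule signed_integral_eq_integral_density[OF integrable_F sets_mu S_eq G int])
  then show "matrix_integral M S G = (\<integral>x. (\<Sum>i\<in>UNIV. \<Sum>j\<in>UNIV. F x $ i $ j * G x $ i $ j) \<partial>\<mu>)"
    unfolding matrix_integral_def using int by simp
qed

end

section \<open>Testing with radial fields\<close>

lemma radial_field_has_derivative:
  fixes f :: "real \<Rightarrow> real" and x b :: "real ^ 'n"
  assumes "(f has_real_derivative D) (at (x \<bullet> x))"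
  shows "((\<lambda>x. f (x \<bullet> x) *\<^sub>R (k *\<^sub>R x + b)) has_derivative
      (\<lambda>h. (f (x \<bullet> x) * k) *\<^sub>R h + (2 * D * (x \<bullet> h)) *\<^sub>R (k *\<^sub>R x + b))) (at x)"
proof -
  have "((\<lambda>x. x \<bullet> x) has_derivative (\<lambda>h. 2 * (x \<bullet> h))) (at x)"
    by (auto intro!: derivative_eq_intros simp: inner_commute)
  then have f: "((\<lambda>x. f (x \<bullet> x)) has_derivative (\<lambda>h. 2 * (x \<bullet> h) * D)) (at x)"
    by (rule DERIV_compose_FDERIV[where f = f and g = "\<lambda>x. x \<bullet> x" and x = x, OF assms])
  show ?thesis
    by (rule derivative_eq_intros f refl)+ (simp add: algebra_simps)
qed

lemma jacobian_radial_field: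
  fixes f :: "real \<Rightarrow> real" and x b :: "real ^ 'n"
  assumes "(f has_real_derivative D) (at (x \<bullet> x))"
  shows "jacobian (\<lambda>x. f (x \<bullet> x) *\<^sub>R (k *\<^sub>R x + b)) (at x) =
    (\<chi> i j. k * f (x \<bullet> x) * of_bool (i = j) + 2 * D * ((k *\<^sub>R x + b) $ i * x $ j))"
proof -
  have "axis j (1 :: real) $ i = of_bool (i = j)" for i j :: 'n
    by (simp add: axis_def)
  then show ?thesis
    unfolding jacobian_def frechet_derivative_at[OF radial_field_has_derivative[OF assms], symmetric]
    by (simp add: matrix_def vec_eq_iff inner_axis algebra_simps)
qed

lemma C1_compact_support_radial_field:
  fixes f f' :: "real \<Rightarrow> real" and b :: "real ^ 'n"
  assumes f: "\<And>q. q \<in> {0..1} \<Longrightarrow> (f has_real_derivative f' q) (at q)"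
    and f': "continuous_on {0..1} f'"
    and t: "t < 1" "\<And>q. t \<le> q \<Longrightarrow> f q = 0"
  shows "C1_compact_support (ball 0 1) (\<lambda>x. f (x \<bullet> x) *\<^sub>R (k *\<^sub>R x + b))"
  unfolding C1_compact_support_def
proof (intro conjI)
  let ?\<Psi> = "\<lambda>x. f (x \<bullet> x) *\<^sub>R (k *\<^sub>R x + b)"
  have q: "x \<bullet> x \<in> {0..1}" if "x \<in> ball 0 1" for x :: "real ^ 'n"
    using that by (simp add: power2_norm_eq_inner[symmetric] power_le_one)
  show "?\<Psi> differentiable_on ball 0 1"
    unfolding differentiable_on_def
  proof
    fix x :: "real ^ 'n" assume "x \<in> ball 0 1"
    from radial_field_has_derivative[OF f[OF q[OF this]]]
    show "?\<Psi> differentiable (at x within ball 0 1)"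
      by (blast intro: differentiableI has_derivative_at_withinI)
  qed
  have f_cont: "continuous_on {0..1} f"
    using f by (meson DERIV_continuous_on has_field_derivative_at_within)
  have comp: "continuous_on (ball 0 1) (\<lambda>x :: real ^ 'n. f (x \<bullet> x))"
    "continuous_on (ball 0 1) (\<lambda>x :: real ^ 'n. f' (x \<bullet> x))"
    using q by (auto intro!: continuous_on_compose2[OF f_cont] continuous_on_compose2[OF f'] continuous_intros)
  have "continuous_on (ball 0 1) (\<lambda>x :: real ^ 'n.
      \<chi> i j. k * f (x \<bullet> x) * of_bool (i = j) + 2 * f' (x \<bullet> x) * ((k *\<^sub>R x + b) $ i * x $ j))"
    by (intro continuous_intros comp)
  then show "continuous_on (ball 0 1) (\<lambda>x. jacobian ?\<Psi> (at x))"
    by (rule continuous_on_eq) (rule jacobian_radial_field[OF f[OF q], symmetric])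
  define \<rho> where "\<rho> = sqrt (max 0 t)"
  have "x \<in> cball 0 \<rho>" if "?\<Psi> x \<noteq> 0" for x
  proof -
    have "x \<bullet> x < t" using that t(2)[of "x \<bullet> x"] by force
    then show ?thesis by (simp add: \<rho>_def norm_eq_sqrt_inner)
  qed
  then have "{x \<in> ball 0 1. ?\<Psi> x \<noteq> 0} \<subseteq> cball 0 \<rho>" by blast
  then have sub: "closure {x \<in> ball 0 1. ?\<Psi> x \<noteq> 0} \<subseteq> cball 0 \<rho>"
    by (rule closure_minimal) simp
  then show "compact (closure {x \<in> ball 0 1. ?\<Psi> x \<noteq> 0})"
    using bounded_cball bounded_subset compact_eq_bounded_closed closed_closure by blast
  have "\<rho> < 1" using t(1) by (simp add: \<rho>_def)
  then show "closure {x \<in> ball 0 1. ?\<Psi> x \<noteq> 0} \<subseteq> ball 0 1"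
    using sub by (auto simp: subset_iff)
qed

text \<open>The term \<open>k f I\<close> of the derivative is paired with \<open>F\<close> to \<open>k f tr F = k f\<close>, and the rank-one term
\<open>2 f' (k x + b) x\<^sup>T\<close> to \<open>2 f' (k x + b) \<bullet> F x\<close>. The case \<open>k = 1\<close>, \<open>b = 0\<close> measures the mass of balls
and does not see \<open>a\<close>, since the field vanishes at the origin; the case \<open>k = 0\<close> isolates \<open>a\<close>.\<close>

lemma radial_field_identity:
  fixes f f' :: "real \<Rightarrow> real" and S :: "(real ^ 'n) set \<Rightarrow> real ^ 'n ^ 'n" and a b :: "real ^ 'n"
    and k :: real
  assumes density: "matrix_measure_density \<mu> (restrict_space borel (ball 0 1)) S F"
    and div: "neg_div_eq_dirac (ball 0 1) S a"
    and f: "\<And>q. q \<in> {0..1} \<Longrightarrow> (f has_real_derivative f' q) (at q)"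
    and f': "continuous_on {0..1} f'"
    and t: "t < 1" "\<And>q. t \<le> q \<Longrightarrow> f q = 0"
  defines "I \<equiv> \<lambda>x. k * f (x \<bullet> x) + 2 * f' (x \<bullet> x) * ((k *\<^sub>R x + b) \<bullet> (F x *v x))"
  shows "integrable \<mu> I" and "(\<integral>x. I x \<partial>\<mu>) = f 0 * (a \<bullet> b)"
proof -
  interpret matrix_measure_density \<mu> "restrict_space borel (ball 0 1)" S F by fact
  define \<Psi> where "\<Psi> = (\<lambda>x. f (x \<bullet> x) *\<^sub>R (k *\<^sub>R x + b))"
  define J where "J = (\<lambda>x. jacobian \<Psi> (at x))"
  have C1: "C1_compact_support (ball 0 1) \<Psi>"
    unfolding \<Psi>_def using f f' t by (rule C1_compact_support_radial_field)
  have space_mu: "space \<mu> = ball 0 1"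
    using sets_eq_imp_space_eq[OF sets_mu] by (simp add: space_restrict_space)
  have q: "x \<bullet> x \<in> {0..1}" if "x \<in> ball 0 1" for x :: "real ^ 'n"
    using that by (simp add: power2_norm_eq_inner[symmetric] power_le_one)
  have J: "J x $ i $ j = k * f (x \<bullet> x) * of_bool (i = j) + 2 * f' (x \<bullet> x) * ((k *\<^sub>R x + b) $ i * x $ j)"
    if "x \<in> ball 0 1" for x i j
    unfolding J_def \<Psi>_def using jacobian_radial_field[OF f[OF q[OF that]]] by simp
  have f_cont: "continuous_on {0..1} f"
    using f by (meson DERIV_continuous_on has_field_derivative_at_within)
  have "bounded (f ` {0..1})" "bounded (f' ` {0..1})"
    by (intro compact_imp_bounded compact_continuous_image f_cont f' compact_Icc)+
  then obtain B B' where B: "\<And>q. q \<in> {0..1} \<Longrightarrow> \<bar>f q\<bar> \<le> B" "\<And>q. q \<in> {0..1} \<Longrightarrow> \<bar>f' q\<bar> \<le> B'"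
    unfolding bounded_iff by (metis imageI real_norm_def)
  have J_bounded: "\<bar>J x $ i $ j\<bar> \<le> \<bar>k\<bar> * B + 2 * B' * ((\<bar>k\<bar> + norm b) * 1)"
    if x: "x \<in> ball 0 1" for x i j
  proof -
    have x1: "norm x \<le> 1" using x by simp
    have entry: "\<bar>x $ j\<bar> \<le> 1" "\<bar>(k *\<^sub>R x + b) $ i\<bar> \<le> \<bar>k\<bar> + norm b"
    proof -
      show "\<bar>x $ j\<bar> \<le> 1" using component_le_norm_cart[of x j] x1 by simp
      have "\<bar>(k *\<^sub>R x + b) $ i\<bar> \<le> norm (k *\<^sub>R x + b)" by (rule component_le_norm_cart)
      also have "\<dots> \<le> \<bar>k\<bar> * norm x + norm b" by (metis norm_scaleR norm_triangle_ineq)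
      also have "\<dots> \<le> \<bar>k\<bar> * 1 + norm b" using x1 by (intro add_right_mono mult_left_mono) auto
      finally show "\<bar>(k *\<^sub>R x + b) $ i\<bar> \<le> \<bar>k\<bar> + norm b" by simp
    qed
    have "\<bar>k * f (x \<bullet> x) * of_bool (i = j)\<bar> \<le> \<bar>k\<bar> * B"
      using B(1)[OF q[OF x]] by (auto simp: abs_mult intro!: mult_left_mono)
    moreover have "\<bar>2 * f' (x \<bullet> x) * ((k *\<^sub>R x + b) $ i * x $ j)\<bar> \<le> 2 * B' * ((\<bar>k\<bar> + norm b) * 1)"
      unfolding abs_mult using B(2)[OF q[OF x]] entry by (intro mult_mono) auto
    ultimately show ?thesis unfolding J[OF x] by linarith
  qed
  have J_meas: "(\<lambda>x. J x $ i $ j) \<in> borel_measurable \<mu>" for i j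
    using C1 unfolding measurable_cong_sets[OF sets_mu refl] J_def C1_compact_support_def
    by (intro borel_measurable_continuous_on_restrict continuous_intros) simp
  have sum_eq: "(\<Sum>i\<in>UNIV. \<Sum>j\<in>UNIV. F x $ i $ j * J x $ i $ j) = I x"
    if x: "x \<in> ball 0 1" and trace: "trace (F x) = 1" for x
  proof -
    have "(\<Sum>i\<in>UNIV. \<Sum>j\<in>UNIV. F x $ i $ j * J x $ i $ j)
        = k * f (x \<bullet> x) * (\<Sum>i\<in>UNIV. \<Sum>j\<in>UNIV. F x $ i $ j * of_bool (i = j))
          + 2 * f' (x \<bullet> x) * (\<Sum>i\<in>UNIV. \<Sum>j\<in>UNIV. F x $ i $ j * ((k *\<^sub>R x + b) $ i * x $ j))"
      unfolding J[OF x] sum_distrib_left sum.distrib[symmetric]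
      by (intro sum.cong refl) (simp add: algebra_simps)
    also have "(\<Sum>i\<in>UNIV. \<Sum>j\<in>UNIV. F x $ i $ j * of_bool (i = j)) = trace (F x)"
      by (simp add: trace_def of_bool_def if_distrib cong: if_cong)
    finally show ?thesis by (simp add: trace I_def inner_matrix_vector_eq_sum)
  qed
  have AE_eq: "AE x in \<mu>. (\<Sum>i\<in>UNIV. \<Sum>j\<in>UNIV. F x $ i $ j * J x $ i $ j) = I x"
    using AE_trace_eq_1 AE_space by eventually_elim (auto intro: sum_eq simp: space_mu)
  have comp: "(\<lambda>x. g (x \<bullet> x)) \<in> borel_measurable \<mu>" if "continuous_on {0..1} g" for g :: "real \<Rightarrow> real"
    unfolding measurable_cong_sets[OF sets_mu refl]
    using q by (intro borel_measurable_continuous_on_restrict continuous_on_compose2[OF that] continuous_intros) auto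
  have [measurable]: "(\<lambda>x. f (x \<bullet> x)) \<in> borel_measurable \<mu>" "(\<lambda>x. f' (x \<bullet> x)) \<in> borel_measurable \<mu>"
    by (intro comp f_cont f')+
  have [measurable]: "(\<lambda>x. x $ i) \<in> borel_measurable \<mu>" for i
    unfolding measurable_cong_sets[OF sets_mu refl]
    by (intro borel_measurable_continuous_on_restrict continuous_intros)
  have I_meas: "I \<in> borel_measurable \<mu>"
    unfolding I_def inner_matrix_vector_eq_sum by simp
  note integral = matrix_integral_eq[of J, OF J_meas J_bounded]
  show "integrable \<mu> I"
    using integral(1) I_meas AE_eq integrable_cong_AE_imp by (auto simp: space_restrict_space)
  have "(\<integral>x. I x \<partial>\<mu>) = (\<integral>x. (\<Sum>i\<in>UNIV. \<Sum>j\<in>UNIV. F x $ i $ j * J x $ i $ j) \<partial>\<mu>)"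
    using I_meas AE_eq J_meas by (intro integral_cong_AE) (auto elim: eventually_mono)
  also have "\<dots> = matrix_integral (restrict_space borel (ball 0 1)) S J"
    by (rule integral(2)[symmetric]) (simp add: space_restrict_space)
  also have "\<dots> = a \<bullet> \<Psi> 0"
    using div C1 by (simp add: neg_div_eq_dirac_def J_def)
  finally show "(\<integral>x. I x \<partial>\<mu>) = f 0 * (a \<bullet> b)" by (simp add: \<Psi>_def)
qed

section \<open>Profiles\<close>

text \<open>A profile is prescribed through its derivative, so that only the continuity of \<open>\<eta>\<close> has to be
arranged in order to obtain a \<open>C\<^sup>1\<close> profile.\<close>

lemma vanishing_antiderivative:
  fixes \<eta> :: "real \<Rightarrow> real"
  assumes \<eta>: "continuous_on UNIV \<eta>" "\<And>q. 0 \<le> \<eta> q" "\<And>q. t \<le> q \<Longrightarrow> \<eta> q = 0"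
  obtains f where "\<And>q. q \<in> {0..1} \<Longrightarrow> (f has_real_derivative - \<eta> q) (at q)"
    "\<And>q. t \<le> q \<Longrightarrow> f q = 0" "\<And>q. 0 \<le> f q"
proof
  \<comment> \<open>The upper limit is taken beyond \<open>1\<close> so that every point of \<open>[0, 1]\<close> is interior to \<open>[-1, 2]\<close>.\<close>
  define f where "f q = integral {q..2} \<eta>" for q
  show "(f has_real_derivative - \<eta> q) (at q)" if "q \<in> {0..1}" for q
    using integral_has_real_derivative'[OF continuous_on_subset[OF \<eta>(1)], of "- 1" 2 q] that
    by (simp add: f_def[abs_def] at_within_Icc_at)
  show "f q = 0" if "t \<le> q" for q
    unfolding f_def using that \<eta>(3) by (intro integral_unique has_integral_is_0) auto
  show "0 \<le> f q" for q
    unfolding f_def using \<eta>(1,2)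
    by (intro integral_nonneg integrable_continuous_interval) (auto intro: continuous_on_subset)
qed

text \<open>A \<open>C\<^sup>1\<close> version of the profile \<open>(max s (min q t))\<^sup>-\<^sup>\<beta> - t\<^sup>-\<^sup>\<beta>\<close>, whose derivative
\<open>- \<beta> q\<^sup>-\<^sup>\<beta>\<^sup>-\<^sup>1\<close> on \<open>[s, t]\<close> is multiplied by a trapezoidal cutoff with ramps on \<open>[s, s']\<close> and
\<open>[t', t]\<close>. The right-hand side of the estimate tends to the difference of weighted indicators as
\<open>s' \<rightarrow> s\<close> and \<open>t' \<rightarrow> t\<close>; its last summand is the price of the lower ramp.\<close>

lemma truncated_power_profile:
  fixes \<beta> s s' t' t :: real
  assumes "0 < \<beta>" "0 < s" "s < s'" "s' < t'" "t' < t" "t < 1"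
  obtains f \<eta> where "\<And>q. q \<in> {0..1} \<Longrightarrow> (f has_real_derivative - \<eta> q) (at q)"
    "continuous_on {0..1} \<eta>" "\<And>q. 0 \<le> \<eta> q" "\<And>q. t \<le> q \<Longrightarrow> f q = 0"
    "\<And>q. q \<in> {0..1} \<Longrightarrow> q * \<eta> q / \<beta> - f q \<le>
        t' powr (- \<beta>) * of_bool (q < t) - s' powr (- \<beta>) * of_bool (q < s)
          + (s powr (- \<beta>) - s' powr (- \<beta>))"
proof -
  note less = assms
  define h where "h q = max 0 (min 1 (min ((q - s) / (s' - s)) ((t - q) / (t - t'))))" for q
  \<comment> \<open>The maximum with \<open>s\<close> is inert where the cutoff is nonzero and avoids the singularity at \<open>0\<close>.\<close>
  define \<eta> where "\<eta> q = \<beta> * (max s q powr (- \<beta> - 1) * h q)" for q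
  have h_le: "0 \<le> h q" "h q \<le> 1" for q by (simp_all add: h_def)
  have h_0: "h q = 0" if "q \<le> s \<or> t \<le> q" for q
  proof -
    have "(q - s) / (s' - s) \<le> 0 \<or> (t - q) / (t - t') \<le> 0"
      using that less by (auto simp: divide_le_0_iff)
    then show ?thesis by (auto simp: h_def min_le_iff_disj)
  qed
  have h_1: "h q = 1" if "s' \<le> q" "q \<le> t'" for q
  proof -
    have "1 \<le> (q - s) / (s' - s)" "1 \<le> (t - q) / (t - t')"
      using that less by (auto simp: le_divide_eq)
    then show ?thesis by (auto simp: h_def)
  qed
  have cont: "continuous_on UNIV \<eta>"
    unfolding \<eta>_def h_def using less by (intro continuous_intros) (auto simp: max_def)
  have nonneg: "0 \<le> \<eta> q" for q using less h_le by (simp add: \<eta>_def)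
  obtain f where f: "\<And>q. q \<in> {0..1} \<Longrightarrow> (f has_real_derivative - \<eta> q) (at q)"
      "\<And>q. t \<le> q \<Longrightarrow> f q = 0" "\<And>q. 0 \<le> f q"
    by (rule vanishing_antiderivative[OF cont nonneg, of t]) (auto simp: \<eta>_def h_0)
  \<comment> \<open>Between the ramps \<open>f\<close> and \<open>q\<^sup>-\<^sup>\<beta>\<close> have the same derivative.\<close>
  have f_middle: "q powr (- \<beta>) - t' powr (- \<beta>) \<le> f q" if q: "s' \<le> q" "q \<le> t'" for q
  proof -
    have "f t' - t' powr (- \<beta>) \<le> f q - q powr (- \<beta>)"
    proof (rule DERIV_nonpos_imp_nonincreasing[OF q(2), of "\<lambda>q. f q - q powr (- \<beta>)"])
      fix u assume u: "q \<le> u" "u \<le> t'"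
      then have "\<eta> u = \<beta> * u powr (- \<beta> - 1)" using q less by (simp add: \<eta>_def h_1)
      then have "((\<lambda>q. f q - q powr (- \<beta>)) has_real_derivative 0) (at u)"
        using u q less by (auto intro!: derivative_eq_intros f(1))
      then show "\<exists>y. ((\<lambda>q. f q - q powr (- \<beta>)) has_real_derivative y) (at u) \<and> y \<le> 0" by blast
    qed
    with f(3)[of t'] show ?thesis by linarith
  qed
  have f_left: "s' powr (- \<beta>) - t' powr (- \<beta>) \<le> f q" if q: "0 \<le> q" "q \<le> s'" for q
  proof -
    have "f s' \<le> f q"
    proof (rule DERIV_nonpos_imp_nonincreasing[OF q(2), of f])
      fix u assume "q \<le> u" "u \<le> s'"
      then have "(f has_real_derivative - \<eta> u) (at u)" using q less by (intro f(1)) auto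
      then show "\<exists>y. (f has_real_derivative y) (at u) \<and> y \<le> 0" using nonneg[of u] by auto
    qed
    with f_middle[of s'] less show ?thesis by linarith
  qed
  have weight: "q * \<eta> q / \<beta> = q powr (- \<beta>) * h q" if "s \<le> q" for q
  proof -
    have "q * q powr (- \<beta> - 1) = q powr (- \<beta>)"
      using that less powr_mult_base[of q "- \<beta> - 1"] by simp
    then show ?thesis using that less by (simp add: \<eta>_def max_absorb2)
  qed
  have weight_le: "q * \<eta> q / \<beta> \<le> q powr (- \<beta>)" if "s \<le> q" for q
    unfolding weight[OF that] using h_le[of q] by (simp add: mult_left_le)
  have antimono: "u powr (- \<beta>) \<le> v powr (- \<beta>)" if "0 < v" "v \<le> u" for u v
    using that less by (intro powr_mono2') auto
  show thesis
  proof
    show "(f has_real_derivative - \<eta> q) (at q)" if "q \<in> {0..1}" for q using that by (rule f)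
    show "continuous_on {0..1} \<eta>" using cont by (rule continuous_on_subset) simp
    show "0 \<le> \<eta> q" for q by (rule nonneg)
    show "f q = 0" if "t \<le> q" for q using that by (rule f)
    fix q :: real assume "q \<in> {0..1}"
    then have q: "0 \<le> q" by simp
    consider "q < s" | "s \<le> q" "q \<le> s'" | "s' \<le> q" "q \<le> t'" | "t' \<le> q" "q < t" | "t \<le> q"
      by linarith
    then show "q * \<eta> q / \<beta> - f q \<le>
        t' powr (- \<beta>) * of_bool (q < t) - s' powr (- \<beta>) * of_bool (q < s)
          + (s powr (- \<beta>) - s' powr (- \<beta>))"
    proof cases
      case 1
      then show ?thesis using f_left[of q] less q antimono[of s s'] by (simp add: \<eta>_def h_0)
    next
      case 2
      then show ?thesis using f_left[of q] weight_le[of q] less q antimono[of s q] by simp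
    next
      case 3
      then show ?thesis using f_middle[of q] weight_le[of q] less q antimono[of s s'] by simp
    next
      case 4
      then show ?thesis
        using f(3)[of q] weight_le[of q] less q antimono[of s s'] antimono[of t' q] by simp
    next
      case 5
      then show ?thesis using f(2)[of q] less antimono[of s s'] by (simp add: \<eta>_def h_0)
    qed
  qed
qed

section \<open>Monotonicity and the vanishing of the force\<close>

text \<open>For the smoothed truncated power the radial identity has, up to the factor \<open>- 1\<close>, an integrand
below \<open>W\<close> almost everywhere, where \<open>W\<close> is a combination of indicators of balls. Hence \<open>W\<close> has nonnegative integral. As the
radial variable is \<open>\<bar>x\<bar>\<^sup>2\<close>, the exponent \<open>\<beta>\<close> is half of \<open>1 / c\<close>.\<close>

lemma scaled_ball_mass_mono:
  fixes S :: "(real ^ 'n) set \<Rightarrow> real ^ 'n ^ 'n"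
  assumes density: "matrix_measure_density \<mu> (restrict_space borel (ball 0 1)) S F"
    and div: "neg_div_eq_dirac (ball 0 1) S a"
    and c: "0 < c"
    and quad: "AE x in \<mu>. \<forall>e. e \<bullet> (F x *v e) \<le> c * (e \<bullet> e)"
    and r: "0 < r" "r < R" "R < 1"
  shows "r powr (- (1 / c)) * trace_measure S (ball 0 r) \<le> R powr (- (1 / c)) * trace_measure S (ball 0 R)"
proof -
  interpret matrix_measure_density \<mu> "restrict_space borel (ball 0 1)" S F by fact
  define \<beta> where "\<beta> = 1 / (2 * c)"
  define m where "m \<rho> = trace_measure S (ball 0 \<rho>)" for \<rho>
  have space_mu: "space \<mu> = ball 0 1"
    using sets_eq_imp_space_eq[OF sets_mu] by (simp add: space_restrict_space)
  have ball_sets: "ball 0 \<rho> \<in> sets \<mu>" if "\<rho> \<le> 1" for \<rho>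
    unfolding sets_mu using that by (auto simp: sets_restrict_space_iff intro: subset_ball)
  have indicator_ball: "(\<integral>x. indicator (ball 0 \<rho>) x \<partial>\<mu>) = m \<rho>" if "\<rho> \<le> 1" for \<rho>
    using ball_sets[OF that] sets.sets_into_space[OF ball_sets[OF that]]
    by (simp add: m_def measure_mu[symmetric] sets_mu[symmetric] Int_absorb1 Int_absorb2)
  have indicator_int: "integrable \<mu> (indicator (ball 0 \<rho>) :: _ \<Rightarrow> real)" if "\<rho> \<le> 1" for \<rho>
    using ball_sets[OF that] by (intro integrable_real_indicator) (simp_all add: less_top[symmetric])
  have "0 < \<beta>" using c by (simp add: \<beta>_def)
  have sq: "0 < r\<^sup>2" "r\<^sup>2 < R\<^sup>2" "R\<^sup>2 < 1"
    using r by (auto simp: power_strict_mono abs_square_less_1)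
  have less_iff: "x \<bullet> x < \<rho>\<^sup>2 \<longleftrightarrow> x \<in> ball 0 \<rho>" if "0 < \<rho>" for \<rho> and x :: "real ^ 'n"
    using that by (simp add: norm_lt_square)
  have approx: "0 \<le> t' powr (- \<beta>) * m R - s' powr (- \<beta>) * m r + ((r\<^sup>2) powr (- \<beta>) - s' powr (- \<beta>)) * m 1"
    if less: "r\<^sup>2 < s'" "s' < t'" "t' < R\<^sup>2" for s' t'
  proof -
    define W where "W x = t' powr (- \<beta>) * indicator (ball 0 R) x - s' powr (- \<beta>) * indicator (ball 0 r) x
        + ((r\<^sup>2) powr (- \<beta>) - s' powr (- \<beta>)) * indicator (ball 0 1) x" for x :: "real ^ 'n"
    obtain f \<eta> where f: "\<And>q. q \<in> {0..1} \<Longrightarrow> (f has_real_derivative - \<eta> q) (at q)"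
        "continuous_on {0..1} \<eta>" "\<And>q. 0 \<le> \<eta> q" "\<And>q. R\<^sup>2 \<le> q \<Longrightarrow> f q = 0"
      and W: "\<And>q. q \<in> {0..1} \<Longrightarrow> q * \<eta> q / \<beta> - f q \<le>
          t' powr (- \<beta>) * of_bool (q < R\<^sup>2) - s' powr (- \<beta>) * of_bool (q < r\<^sup>2)
            + ((r\<^sup>2) powr (- \<beta>) - s' powr (- \<beta>))"
      using truncated_power_profile[OF \<open>0 < \<beta>\<close> sq(1) less sq(3)] by blast
    define I where "I x = 1 * f (x \<bullet> x) + 2 * (- \<eta> (x \<bullet> x)) * ((1 *\<^sub>R x + 0) \<bullet> (F x *v x))" for x
    have cont: "continuous_on {0..1} (\<lambda>q. - \<eta> q)" using f(2) by (intro continuous_intros)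
    have I: "integrable \<mu> I" "(\<integral>x. I x \<partial>\<mu>) = 0"
      using radial_field_identity[OF density div f(1) cont sq(3) f(4), of 1 0] by (simp_all add: I_def[abs_def])
    have "AE x in \<mu>. - W x \<le> I x"
      using quad AE_space
    proof eventually_elim
      case (elim x)
      then have x: "x \<in> ball 0 1" by (simp add: space_mu)
      then have q: "x \<bullet> x \<in> {0..1}" by (simp add: power2_norm_eq_inner[symmetric] power_le_one)
      have "2 * \<eta> (x \<bullet> x) * (x \<bullet> (F x *v x)) \<le> 2 * \<eta> (x \<bullet> x) * (c * (x \<bullet> x))"
        using elim(1) f(3)[of "x \<bullet> x"] by (intro mult_left_mono) auto
      also have "\<dots> = x \<bullet> x * \<eta> (x \<bullet> x) / \<beta>" using c by (simp add: \<beta>_def field_simps)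
      finally show ?case
        using W[OF q] x r by (simp add: I_def W_def less_iff indicator_def of_bool_def)
    qed
    moreover have W_int: "integrable \<mu> W"
      unfolding W_def using r
      by (intro Bochner_Integration.integrable_add Bochner_Integration.integrable_diff
           integrable_mult_right indicator_int) auto
    ultimately have "(\<integral>x. - W x \<partial>\<mu>) \<le> (\<integral>x. I x \<partial>\<mu>)"
      using I(1) by (intro integral_mono_AE) auto
    then have "0 \<le> (\<integral>x. W x \<partial>\<mu>)" using I(2) by simp
    also have "(\<integral>x. W x \<partial>\<mu>) = t' powr (- \<beta>) * m R - s' powr (- \<beta>) * m r
        + ((r\<^sup>2) powr (- \<beta>) - s' powr (- \<beta>)) * m 1"
      unfolding W_def using r indicator_int indicator_ball
      by simp
    finally show ?thesis .
  qed
  \<comment> \<open>Both ramps of the cutoff are shrunk simultaneously, with width \<open>\<epsilon>\<close>.\<close>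
  define G where "G \<epsilon> = (R\<^sup>2 - \<epsilon>) powr (- \<beta>) * m R - (r\<^sup>2 + \<epsilon>) powr (- \<beta>) * m r
      + ((r\<^sup>2) powr (- \<beta>) - (r\<^sup>2 + \<epsilon>) powr (- \<beta>)) * m 1" for \<epsilon>
  have "isCont G 0"
    unfolding G_def using sq by (intro continuous_intros) auto
  then have "(G \<longlongrightarrow> G 0) (at_right 0)"
    by (simp add: isCont_def filterlim_at_split)
  moreover have "\<forall>\<^sub>F \<epsilon> in at_right 0. 0 \<le> G \<epsilon>"
    unfolding eventually_at_right_field
  proof (intro exI conjI allI impI)
    show "0 < (R\<^sup>2 - r\<^sup>2) / 2" using sq by simp
    show "0 \<le> G \<epsilon>" if "0 < \<epsilon>" "\<epsilon> < (R\<^sup>2 - r\<^sup>2) / 2" for \<epsilon>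
      unfolding G_def using that by (intro approx) auto
  qed
  ultimately have "0 \<le> G 0"
    by (rule tendsto_lowerbound) simp
  moreover have "(\<rho>\<^sup>2) powr (- \<beta>) = \<rho> powr (- (1 / c))" if "0 < \<rho>" for \<rho>
    using that by (simp add: \<beta>_def powr_powr flip: powr_numeral)
  ultimately show ?thesis using r by (simp add: G_def m_def)
qed

text \<open>A point force needs mass of order \<open>\<epsilon>\<close> in the ball of radius \<open>\<epsilon>\<close> to balance it: a cutoff at scale
\<open>\<epsilon>\<close> has gradient of order \<open>1 / \<epsilon>\<close>. Growth of the mass with an exponent above \<open>1\<close> excludes this.\<close>

lemma concentrated_force_eq_0:
  fixes S :: "(real ^ 'n) set \<Rightarrow> real ^ 'n ^ 'n"
  assumes density: "matrix_measure_density \<mu> (restrict_space borel (ball 0 1)) S F"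
    and div: "neg_div_eq_dirac (ball 0 1) S a"
    and p: "1 < p"
    and growth: "\<And>\<epsilon>. 0 < \<epsilon> \<Longrightarrow> \<epsilon> < 1 / 2 \<Longrightarrow> trace_measure S (ball 0 \<epsilon>) \<le> K * \<epsilon> powr p"
  shows "a = 0"
proof -
  interpret matrix_measure_density \<mu> "restrict_space borel (ball 0 1)" S F by fact
  define N where "N = real CARD('n)"
  have space_mu: "space \<mu> = ball 0 1"
    using sets_eq_imp_space_eq[OF sets_mu] by (simp add: space_restrict_space)
  have bound: "a \<bullet> a \<le> (4 * N\<^sup>2 * norm a * K) * \<epsilon> powr (p - 1)" if \<epsilon>: "0 < \<epsilon>" "\<epsilon> < 1 / 2" for \<epsilon>
  proof -
    have ball_sets: "ball 0 \<epsilon> \<in> sets \<mu>"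
      unfolding sets_mu using \<epsilon> by (auto simp: sets_restrict_space_iff intro: subset_ball)
    have ball_measure: "measure \<mu> (ball 0 \<epsilon>) = trace_measure S (ball 0 \<epsilon>)"
      using ball_sets by (intro measure_mu) (simp add: sets_mu)
    have sq: "0 < \<epsilon>\<^sup>2" "\<epsilon>\<^sup>2 < 1" using \<epsilon> by (auto simp: abs_square_less_1)
    \<comment> \<open>This prescribes the profile \<open>(max 0 (\<epsilon>\<^sup>2 - q))\<^sup>2 / 2\<close>.\<close>
    define \<eta> where "\<eta> q = max 0 (\<epsilon>\<^sup>2 - q)" for q :: real
    have cont: "continuous_on A \<eta>" for A unfolding \<eta>_def by (intro continuous_intros)
    obtain f where f: "\<And>q. q \<in> {0..1} \<Longrightarrow> (f has_real_derivative - \<eta> q) (at q)"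
        "\<And>q. \<epsilon>\<^sup>2 \<le> q \<Longrightarrow> f q = 0"
      by (rule vanishing_antiderivative[OF cont, of "\<epsilon>\<^sup>2"]) (auto simp: \<eta>_def)
    have "f (\<epsilon>\<^sup>2) - (\<epsilon>\<^sup>2 - \<epsilon>\<^sup>2)\<^sup>2 / 2 \<le> f 0 - (\<epsilon>\<^sup>2 - 0)\<^sup>2 / 2"
    proof (rule DERIV_nonpos_imp_nonincreasing[of 0 "\<epsilon>\<^sup>2" "\<lambda>q. f q - (\<epsilon>\<^sup>2 - q)\<^sup>2 / 2"])
      fix u assume u: "0 \<le> u" "u \<le> \<epsilon>\<^sup>2"
      then have "((\<lambda>q. f q - (\<epsilon>\<^sup>2 - q)\<^sup>2 / 2) has_real_derivative 0) (at u)"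
        using sq by (auto intro!: derivative_eq_intros f(1) simp: \<eta>_def)
      then show "\<exists>y. ((\<lambda>q. f q - (\<epsilon>\<^sup>2 - q)\<^sup>2 / 2) has_real_derivative y) (at u) \<and> y \<le> 0" by blast
    qed simp
    then have f_0: "\<epsilon> ^ 4 / 2 \<le> f 0" using f(2)[of "\<epsilon>\<^sup>2"] by simp
    define I where "I x = 0 * f (x \<bullet> x) + 2 * (- \<eta> (x \<bullet> x)) * ((0 *\<^sub>R x + a) \<bullet> (F x *v x))" for x
    have cont': "continuous_on {0..1} (\<lambda>q. - \<eta> q)" using cont by (intro continuous_intros)
    have I: "integrable \<mu> I" "(\<integral>x. I x \<partial>\<mu>) = f 0 * (a \<bullet> a)"
      using radial_field_identity[OF density div f(1) cont' sq(2) f(2), of 0 a] by (simp_all add: I_def[abs_def])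
    define C where "C = 2 * \<epsilon>\<^sup>2 * (N\<^sup>2 * (norm a * \<epsilon>))"
    have "AE x in \<mu>. I x \<le> C * indicator (ball 0 \<epsilon>) x"
      using AE_entry_le_1
    proof eventually_elim
      case (elim x)
      show ?case
      proof (cases "x \<in> ball 0 \<epsilon>")
        case True
        have "\<bar>a \<bullet> (F x *v x)\<bar> \<le> (\<Sum>i\<in>(UNIV :: 'n set). \<Sum>j\<in>(UNIV :: 'n set). norm a * \<epsilon>)"
          unfolding inner_matrix_vector_eq_sum
        proof (intro order.trans[OF sum_abs] sum_mono)
          fix i j
          have "\<bar>F x $ i $ j\<bar> * (\<bar>a $ i\<bar> * \<bar>x $ j\<bar>) \<le> 1 * (norm a * \<epsilon>)"
            using elim True component_le_norm_cart[of a i] component_le_norm_cart[of x j]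
            by (intro mult_mono) auto
          then show "\<bar>F x $ i $ j * (a $ i * x $ j)\<bar> \<le> norm a * \<epsilon>" by (simp add: abs_mult)
        qed
        also have "\<dots> = N\<^sup>2 * (norm a * \<epsilon>)" by (simp add: N_def power2_eq_square)
        finally have inner_le: "\<bar>a \<bullet> (F x *v x)\<bar> \<le> N\<^sup>2 * (norm a * \<epsilon>)" .
        have "\<bar>I x\<bar> = 2 * \<eta> (x \<bullet> x) * \<bar>a \<bullet> (F x *v x)\<bar>"
          by (simp add: I_def abs_mult) (simp add: \<eta>_def)
        also have "\<dots> \<le> 2 * \<epsilon>\<^sup>2 * (N\<^sup>2 * (norm a * \<epsilon>))"
          using inner_le by (intro mult_mono) (auto simp: \<eta>_def)
        finally show ?thesis using True by (simp add: C_def)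
      next
        case False
        then have "\<epsilon>\<^sup>2 \<le> x \<bullet> x"
          using \<epsilon> by (simp add: power2_norm_eq_inner[symmetric] power_mono)
        then show ?thesis using False by (simp add: I_def \<eta>_def)
      qed
    qed
    then have "(\<integral>x. I x \<partial>\<mu>) \<le> (\<integral>x. C * indicator (ball 0 \<epsilon>) x \<partial>\<mu>)"
      using I(1) ball_sets
      by (intro integral_mono_AE integrable_mult_right integrable_real_indicator)
         (simp_all add: less_top[symmetric])
    also have "\<dots> = C * trace_measure S (ball 0 \<epsilon>)"
      using ball_sets sets.sets_into_space[OF ball_sets] by (simp add: ball_measure Int_absorb1 Int_absorb2)
    also have "\<dots> \<le> C * (K * \<epsilon> powr p)"
      using \<epsilon> by (intro mult_left_mono growth) (auto simp: C_def N_def)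
    finally have "\<epsilon> ^ 4 / 2 * (a \<bullet> a) \<le> C * (K * \<epsilon> powr p)"
      using mult_right_mono[OF f_0, of "a \<bullet> a"] I(2) by simp
    also have "\<epsilon> powr p = \<epsilon> * \<epsilon> powr (p - 1)"
      using \<epsilon> by (simp add: powr_mult_base)
    also have "C * (K * (\<epsilon> * \<epsilon> powr (p - 1))) = \<epsilon> ^ 4 / 2 * ((4 * N\<^sup>2 * norm a * K) * \<epsilon> powr (p - 1))"
      by (simp add: C_def power2_eq_square power4_eq_xxxx)
    finally show ?thesis using \<epsilon> by (simp add: mult_le_cancel_left_pos mult_ac)
  qed
  have "((\<lambda>\<epsilon>. (4 * N\<^sup>2 * norm a * K) * \<epsilon> powr (p - 1)) \<longlongrightarrow> (4 * N\<^sup>2 * norm a * K) * 0 powr (p - 1)) (at_right 0)"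
    using p by (intro tendsto_intros tendsto_powr2) (auto simp: eventually_at_right_less less_imp_le
        intro: eventually_mono[OF eventually_at_right_less])
  moreover have "\<forall>\<^sub>F \<epsilon> in at_right 0. a \<bullet> a \<le> (4 * N\<^sup>2 * norm a * K) * \<epsilon> powr (p - 1)"
    unfolding eventually_at_right_field using bound by (intro exI[of _ "1 / 2"]) auto
  ultimately have "a \<bullet> a \<le> (4 * N\<^sup>2 * norm a * K) * 0 powr (p - 1)"
    by (rule tendsto_lowerbound) simp
  then have "a \<bullet> a = 0" using inner_ge_zero[of a] by simp
  then show "a = 0" by simp
qed

theorem lemma3p13:
  fixes S :: "(real ^ 'n) set \<Rightarrow> real ^ 'n ^ 'n"
    and a :: "real ^ 'n"
    and c :: real
  assumes S: "sym_psd_measure (restrict_space borel (ball 0 1)) S"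
    and div: "neg_div_eq_dirac (ball 0 1) S a"
    and c: "0 < c" "c \<le> 1"
    and quad_le: "\<And>e A. e \<in> sphere 0 1 \<Longrightarrow> A \<in> sets (restrict_space borel (ball 0 1)) \<Longrightarrow>
           quad_measure e S A \<le> c * trace_measure S A"
  shows "mono_on {0<..<1} (\<lambda>r. r powr (- (1 / c)) * trace_measure S (ball 0 r)) \<and>
         (c < 1 \<longrightarrow> a = 0)"
proof -
  obtain \<mu> F where density: "matrix_measure_density \<mu> (restrict_space borel (ball 0 1)) S F"
    using sym_psd_measure_has_density[OF S] .
  have quad: "AE x in \<mu>. \<forall>e. e \<bullet> (F x *v e) \<le> c * (e \<bullet> e)"
    using matrix_measure_density.AE_quadratic_form_le[OF density quad_le] .
  have mono: "r powr (- (1 / c)) * trace_measure S (ball 0 r) \<le> R powr (- (1 / c)) * trace_measure S (ball 0 R)"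
    if "0 < r" "r < R" "R < 1" for r R
    using scaled_ball_mass_mono[OF density div c(1) quad that] .
  have "a = 0" if "c < 1"
  proof (rule concentrated_force_eq_0[OF density div])
    show "1 < 1 / c" using that c by simp
    define K where "K = (1 / 2) powr (- (1 / c)) * trace_measure S (ball 0 (1 / 2))"
    show "trace_measure S (ball 0 \<epsilon>) \<le> K * \<epsilon> powr (1 / c)" if "0 < \<epsilon>" "\<epsilon> < 1 / 2" for \<epsilon>
      using mono[of \<epsilon> "1 / 2"] that by (simp add: K_def powr_minus field_simps)
  qed
  moreover have "mono_on {0<..<1} (\<lambda>r. r powr (- (1 / c)) * trace_measure S (ball 0 r))"
  proof (rule mono_onI)
    fix r R :: real assume "r \<in> {0<..<1}" "R \<in> {0<..<1}" "r \<le> R"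
    then show "r powr (- (1 / c)) * trace_measure S (ball 0 r) \<le> R powr (- (1 / c)) * trace_measure S (ball 0 R)"
      using mono[of r R] by (cases "r = R") auto
  qed
  ultimately show ?thesis by blast
qed

end
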